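(* Let $f\colon\mathbb{R}^d\to\mathbb{R}$ be convex and differentiable with locally Lipschitz gradient $\nabla f$, and assume that the problem $\min_{x\in\mathbb{R}^d} f(x)$ has a solution. Let $x^0\in\mathbb{R}^d$, $t_0>0$, $\theta_0>0$, $\delta\in(0,1)$, and let $\{\gamma_k\}_{k\ge1}$ be a sequence of real numbers with $\gamma_k\ge 0$ and $\sum_{k=1}^\infty\gamma_k<\infty$. Let $\{x^k\}$ be generated by $x^{k+1}=x^k-t_k\nabla f(x^k)$, $k\ge0$, where for every $k\ge1$ the stepsize satisfies $t_k\in[l_k^{(2)},u_k^{(2)}]$ with $$l_k^{(2)}=\min\left\{\sqrt{\tfrac23+\theta_{k-1}}\,t_{k-1},\ \frac{\delta}{\sqrt2 L_k}\right\},\qquad u_k^{(2)}=\min\left\{\sqrt{\tfrac23+\theta_{k-1}}\,t_{k-1},\ \sqrt{\frac{1+\frac{\gamma_k}{\|x^k-x^{k-1}\|^2}}{[2t_{k-1}^2L_k^2-1]_+}}\;t_{k-1}\right\}.$$ Then the sequence $\{x^k\}$ is bounded, and every accumulation point of $\{x^k\}$ is a solution of $\min_{x\in\mathbb{R}^d}f(x)$.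
   Context: $\|\cdot\|$ is the Euclidean norm and $[t]_+=\max\{t,0\}$. For $k\ge1$, $L_k=\dfrac{\|\nabla f(x^k)-\nabla f(x^{k-1})\|}{\|x^k-x^{k-1}\|}$ and $\theta_k=\dfrac{t_k}{t_{k-1}}$; $\theta_0$ is a given initial value. Conventions: the iteration does not terminate, i.e. $\nabla f(x^k)\ne0$ for all $k$ (so $x^k\neq x^{k-1}$ and $L_k$ is defined), and a quotient $c/0$ with $c>0$ (when $L_k=0$ or $[2t_{k-1}^2L_k^2-1]_+=0$) is read as $+\infty$. *)

theory Defs
  imports "HOL-Analysis.Analysis"
begin

definition locally_lipschitz :: "('a::metric_space \<Rightarrow> 'b::metric_space) \<Rightarrow> bool" where
  "locally_lipschitz g \<longleftrightarrow> (\<forall>z. \<exists>r>0. \<exists>C. C-lipschitz_on (ball z r) g)"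

definition accumulation_point :: "(nat \<Rightarrow> 'a::topological_space) \<Rightarrow> 'a \<Rightarrow> bool" where
  "accumulation_point x p \<longleftrightarrow> (\<exists>r. strict_mono r \<and> (x \<circ> r) \<longlonglongrightarrow> p)"

text \<open>Only used on \<open>[0, \<infinity>]\<close>.\<close>

definition ereal_sqrt :: "ereal \<Rightarrow> ereal" where
  "ereal_sqrt c = (if c = \<infinity> then \<infinity> else ereal (sqrt (real_of_ereal c)))"

text \<open>In the following, \<open>g\<close> is the gradient map, \<open>x\<close> the iterates, \<open>t\<close> the stepsizes and \<open>\<theta>\<close> the
  stepsize ratios; all definitions are meant for indices \<open>k \<ge> 1\<close>.\<close>

definition local_lip :: "('a::real_normed_vector \<Rightarrow> 'a) \<Rightarrow> (nat \<Rightarrow> 'a) \<Rightarrow> nat \<Rightarrow> real" where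
  "local_lip g x k = norm (g (x k) - g (x (k - 1))) / norm (x k - x (k - 1))"

text \<open>The bounds are extended reals: division on \<open>ereal\<close> satisfies \<open>c / 0 = \<infinity>\<close> for \<open>c > 0\<close>,
  whereas division on \<open>real\<close> would give \<open>0\<close>.\<close>

definition step_lower ::
  "('a::real_normed_vector \<Rightarrow> 'a) \<Rightarrow> real \<Rightarrow> (nat \<Rightarrow> 'a) \<Rightarrow> (nat \<Rightarrow> real) \<Rightarrow> (nat \<Rightarrow> real) \<Rightarrow> nat \<Rightarrow> ereal"
where
  "step_lower g \<delta> x t \<theta> k =
     min (ereal (sqrt (2 / 3 + \<theta> (k - 1)) * t (k - 1)))
         (ereal \<delta> / ereal (sqrt 2 * local_lip g x k))"

definition step_upper ::
  "('a::real_normed_vector \<Rightarrow> 'a) \<Rightarrow> (nat \<Rightarrow> real) \<Rightarrow> (nat \<Rightarrow> 'a) \<Rightarrow> (nat \<Rightarrow> real) \<Rightarrow> (nat \<Rightarrow> real)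
     \<Rightarrow> nat \<Rightarrow> ereal"
where
  "step_upper g \<gamma> x t \<theta> k =
     min (ereal (sqrt (2 / 3 + \<theta> (k - 1)) * t (k - 1)))
         (ereal_sqrt (ereal (1 + \<gamma> k / (norm (x k - x (k - 1)))\<^sup>2)
              / ereal (max (2 * (t (k - 1))\<^sup>2 * (local_lip g x k)\<^sup>2 - 1) 0))
           * ereal (t (k - 1)))"

end

theory Submission
  imports Defs
begin

text \<open>
  Fix a minimizer \<open>z\<close> of \<open>f\<close>. Expanding the square of \<open>x (k + 1) - z\<close> gives the usual identity of
  gradient descent, in which \<open>(t k)\<^sup>2 * (norm (g (x k)))\<^sup>2\<close> is the only term of the wrong sign. The
  stepsize rule is made to absorb the double of this term. One half of the rule, \<open>t k\<close> against
  \<open>L k\<close>, bounds that double by the square of the previous step, plus \<open>\<gamma> k\<close>, plus a multiple of the inner product of two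
  successive gradients; convexity turns that inner product into a decrease of function values, and the other half of the rule, the
  growth restriction \<open>(t k)\<^sup>2 \<le> (2/3 + \<theta> (k - 1)) * (t (k - 1))\<^sup>2\<close>, makes these decreases telescope.
  So the energy
  \<open>(norm (x (k + 1) - z))\<^sup>2 + (norm (x (k + 1) - x k))\<^sup>2 + t k * (2 + 3 * \<theta> k) * (f (x k) - f z)\<close>
  grows at step \<open>k\<close> by at most \<open>\<gamma> k\<close> (\<open>energy_decrease\<close>). As \<open>\<gamma>\<close> is summable, the energy and hence
  the iterates are bounded.

  The telescoped function values do not show that \<open>f (x k)\<close> tends to the minimum, because their
  coefficients may vanish. The information comes from a term that the convexity estimate usually
  discards: the energy even loses \<open>2 * t k * D k\<close>, where \<open>D k\<close> is the Bregman distance from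
  \<open>z\<close> to \<open>x k\<close>. Therefore \<open>t k * D k\<close> is summable. On the bounded set of iterates the
  gradient is Lipschitz along steps, so the lower bound of the stepsize rule keeps \<open>t k\<close> away from
  \<open>0\<close> (\<open>stepsizes_bounded_below\<close>), and \<open>D k\<close> tends to \<open>0\<close>. At an accumulation point \<open>p\<close> the Bregman
  distance from \<open>z\<close> to \<open>p\<close> then vanishes, which forces the gradients at \<open>p\<close> and \<open>z\<close> to agree
  (\<open>bregman_eq_0_imp_gradient_eq\<close>). Hence the gradient at \<open>p\<close> is \<open>0\<close> and \<open>p\<close> is a minimizer.
\<close>

section \<open>Differentiable convex functions\<close>

lemma convex_gradient_inequality:
  fixes f :: "'a::real_inner \<Rightarrow> real"
  assumes "convex_on UNIV f" and "GDERIV f x :> v"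
  shows "f x + inner v (y - x) \<le> f y"
proof -
  define h where "h u = f (x + u *\<^sub>R (y - x))" for u :: real
  have "convex_on UNIV h"
  proof (rule convex_onI)
    fix s a b :: real
    assume s: "0 < s" "s < 1"
    have "x + ((1 - s) *\<^sub>R a + s *\<^sub>R b) *\<^sub>R (y - x)
        = (1 - s) *\<^sub>R (x + a *\<^sub>R (y - x)) + s *\<^sub>R (x + b *\<^sub>R (y - x))"
      by (simp add: algebra_simps)
    then show "h ((1 - s) *\<^sub>R a + s *\<^sub>R b) \<le> (1 - s) * h a + s * h b"
      using convex_onD[OF assms(1), of s "x + a *\<^sub>R (y - x)" "x + b *\<^sub>R (y - x)"] s
      by (simp add: h_def)
  qed simp
  moreover have "(h has_field_derivative inner v (y - x)) (at 0)"
  proof -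
    have "((\<lambda>u. x + u *\<^sub>R (y - x)) has_derivative (\<lambda>u. u *\<^sub>R (y - x))) (at 0)"
      by (auto intro!: derivative_eq_intros)
    moreover have "(f has_derivative (\<lambda>d. inner d v)) (at (x + 0 *\<^sub>R (y - x)))"
      using assms(2) by (simp add: gderiv_def inner_commute)
    ultimately have "(h has_derivative (\<lambda>u. inner (u *\<^sub>R (y - x)) v)) (at 0)"
      unfolding h_def by (rule has_derivative_compose)
    moreover have "(\<lambda>u. inner (u *\<^sub>R (y - x)) v) = (*) (inner v (y - x))"
      by (auto simp: inner_commute)
    ultimately show ?thesis by (simp add: has_field_derivative_def)
  qed
  ultimately have "h 1 - h 0 \<ge> inner v (y - x) * (1 - 0)"
    by (intro convex_on_imp_above_tangent[of UNIV]) auto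
  then show ?thesis by (simp add: h_def)
qed

lemma convex_gradient_monotone:
  fixes f :: "'a::real_inner \<Rightarrow> real"
  assumes "convex_on UNIV f" and "\<And>z. GDERIV f z :> g z"
  shows "0 \<le> inner (g x - g y) (x - y)"
  using convex_gradient_inequality[OF assms(1) assms(2), of x y]
    convex_gradient_inequality[OF assms(1) assms(2), of y x]
  by (simp add: inner_diff_left inner_diff_right)

lemma gradient_at_minimum:
  fixes f :: "'a::real_inner \<Rightarrow> real"
  assumes "GDERIV f z :> v" and "\<And>y. f z \<le> f y"
  shows "v = 0"
proof -
  have "(\<lambda>h. inner h v) = (\<lambda>h. 0)"
    using assms by (intro has_derivative_local_min[of f _ z]) (auto simp: gderiv_def)
  then have "inner v v = 0" by meson
  then show ?thesis by simp
qed

definition bregman :: "('a::real_inner \<Rightarrow> real) \<Rightarrow> ('a \<Rightarrow> 'a) \<Rightarrow> 'a \<Rightarrow> 'a \<Rightarrow> real" where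
  "bregman f g y x = f y - f x - inner (g x) (y - x)"

lemma bregman_nonneg:
  assumes "convex_on UNIV f" and "\<And>z. GDERIV f z :> g z"
  shows "0 \<le> bregman f g y x"
  using convex_gradient_inequality[OF assms(1) assms(2), of x y] by (simp add: bregman_def)

text \<open>The function \<open>\<lambda>w. bregman f g w x\<close> is nonnegative, so \<open>y\<close> minimizes it, and its gradient
  \<open>g y - g x\<close> at \<open>y\<close> vanishes. The points \<open>y\<close> and \<open>x\<close> themselves may differ.\<close>

lemma bregman_eq_0_imp_gradient_eq:
  assumes "convex_on UNIV f" and "\<And>z. GDERIV f z :> g z" and "bregman f g y x = 0"
  shows "g y = g x"
proof -
  have "GDERIV (\<lambda>w. bregman f g w x) y :> g y - g x"
    using assms(2)[of y] unfolding gderiv_def bregman_def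
    by (auto intro!: derivative_eq_intros simp: inner_diff_right inner_diff_left inner_commute)
  moreover have "bregman f g y x \<le> bregman f g w x" for w
    using bregman_nonneg[OF assms(1,2)] assms(3) by simp
  ultimately have "g y - g x = 0" by (rule gradient_at_minimum)
  then show ?thesis by simp
qed

section \<open>Locally Lipschitz maps along bounded sequences\<close>

lemma locally_lipschitz_imp_local_lipschitz:
  assumes "locally_lipschitz g"
  shows "local_lipschitz UNIV UNIV (\<lambda>_::real. g)"
proof (rule local_lipschitzI)
  fix t :: real and z
  obtain r C where "r > 0" "C-lipschitz_on (ball z r) g"
    using assms unfolding locally_lipschitz_def by blast
  then have "C-lipschitz_on (cball z (r / 2) \<inter> UNIV) g"
    by (auto intro: lipschitz_on_subset)
  then show "\<exists>u>0. \<exists>L. \<forall>t\<in>cball t u \<inter> UNIV. L-lipschitz_on (cball z u \<inter> UNIV) g"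
    using \<open>r > 0\<close> by (intro exI[of _ "r / 2"]) auto
qed

lemma locally_lipschitz_bounded_imp_lipschitz:
  fixes g :: "'a::heine_borel \<Rightarrow> 'b::metric_space"
  assumes "locally_lipschitz g" and "bounded S"
  obtains C where "C-lipschitz_on S g"
proof -
  have "local_lipschitz {0::real} (closure S) (\<lambda>_. g)"
    using locally_lipschitz_imp_local_lipschitz[OF assms(1)]
    by (rule local_lipschitz_subset) auto
  moreover have "compact (closure S)" using assms(2) by simp
  ultimately obtain C where "\<And>t. t \<in> {0::real} \<Longrightarrow> C-lipschitz_on (closure S) g"
    by (rule local_lipschitz_compact_implies_lipschitz) auto
  then have "C-lipschitz_on S g"
    using lipschitz_on_subset[OF _ closure_subset] by simp
  then show ?thesis by (rule that)
qed

lemma locally_lipschitz_imp_continuous: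
  assumes "locally_lipschitz g"
  shows "continuous_on UNIV g"
  using local_lipschitz_continuous_on[OF locally_lipschitz_imp_local_lipschitz[OF assms]]
  by blast

text \<open>The bound is stated as positive because the lower stepsize bound divides by it. Where
  \<open>x k = x (k - 1)\<close>, in particular at \<open>k = 0\<close>, the quotient has the value \<open>0\<close>.\<close>

lemma local_lip_bounded:
  fixes g :: "'a::euclidean_space \<Rightarrow> 'a"
  assumes "locally_lipschitz g" and "bounded (range x)"
  obtains C where "0 < C" "\<And>k. local_lip g x k \<le> C"
proof -
  obtain C where C: "C-lipschitz_on (range x) g"
    using locally_lipschitz_bounded_imp_lipschitz[OF assms] .
  have "local_lip g x k \<le> C + 1" for k
  proof -
    have "norm (g (x k) - g (x (k - 1))) \<le> C * norm (x k - x (k - 1))"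
      using lipschitz_onD[OF C, of "x k" "x (k - 1)"] by (simp add: dist_norm)
    then have "local_lip g x k \<le> C"
      using lipschitz_on_nonneg[OF C] by (cases "x k = x (k - 1)") (auto simp: local_lip_def field_simps)
    then show ?thesis by simp
  qed
  then show ?thesis using lipschitz_on_nonneg[OF C] by (intro that[of "C + 1"]) auto
qed

section \<open>The stepsize rule in real numbers\<close>

text \<open>The quotient \<open>\<delta> / (sqrt 2 * L k)\<close> may be infinite; against a positive upper bound \<open>C\<close> of
  \<open>L k\<close> it can be replaced by a real number.\<close>

lemma step_lower_real:
  assumes "step_lower g \<delta> x t \<theta> k \<le> ereal s" and "0 < \<delta>" and "0 < C" and "local_lip g x k \<le> C"
  shows "min (sqrt (2 / 3 + \<theta> (k - 1)) * t (k - 1)) (\<delta> / (sqrt 2 * C)) \<le> s"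
proof -
  define L where "L = local_lip g x k"
  have "0 \<le> L" by (simp add: L_def local_lip_def)
  have "ereal (\<delta> / (sqrt 2 * C)) \<le> ereal \<delta> / ereal (sqrt 2 * L)"
  proof (cases "L = 0")
    case True
    then show ?thesis using \<open>0 < \<delta>\<close> by simp
  next
    case False
    then show ?thesis
      using \<open>0 \<le> L\<close> assms(2-4) unfolding L_def by (auto intro!: divide_left_mono mult_pos_pos)
  qed
  then have "ereal (min (sqrt (2 / 3 + \<theta> (k - 1)) * t (k - 1)) (\<delta> / (sqrt 2 * C)))
      \<le> step_lower g \<delta> x t \<theta> k"
    unfolding step_lower_def L_def[symmetric] by (auto simp: min_def)
  then have "ereal (min (sqrt (2 / 3 + \<theta> (k - 1)) * t (k - 1)) (\<delta> / (sqrt 2 * C))) \<le> ereal s"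
    using assms(1) by (rule order_trans)
  then show ?thesis by (simp only: ereal_less_eq)
qed

lemma step_upper_growth:
  assumes "ereal s \<le> step_upper g \<gamma> x t \<theta> k" and "0 \<le> s" and "0 \<le> \<theta> (k - 1)"
  shows "s\<^sup>2 \<le> (2 / 3 + \<theta> (k - 1)) * (t (k - 1))\<^sup>2"
proof -
  have "s \<le> sqrt (2 / 3 + \<theta> (k - 1)) * t (k - 1)"
    using assms(1) by (simp add: step_upper_def)
  then have "s\<^sup>2 \<le> (sqrt (2 / 3 + \<theta> (k - 1)) * t (k - 1))\<^sup>2"
    using assms(2) by (rule power_mono)
  then show ?thesis using assms(3) by (simp add: power_mult_distrib)
qed

text \<open>Clearing the denominator removes the case distinction of the extended reals: where the positive
  part vanishes, the left-hand side is not positive.\<close>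

lemma step_upper_curvature:
  assumes "ereal s \<le> step_upper g \<gamma> x t \<theta> k" and "0 \<le> s" and "0 < t (k - 1)"
    and "0 \<le> \<gamma> k"
  shows "s\<^sup>2 * (2 * (t (k - 1))\<^sup>2 * (local_lip g x k)\<^sup>2 - 1)
    \<le> (1 + \<gamma> k / (norm (x k - x (k - 1)))\<^sup>2) * (t (k - 1))\<^sup>2"
proof -
  define A where "A = 1 + \<gamma> k / (norm (x k - x (k - 1)))\<^sup>2"
  define B where "B = 2 * (t (k - 1))\<^sup>2 * (local_lip g x k)\<^sup>2 - 1"
  have "0 < A" using assms(4) by (simp add: A_def add_pos_nonneg)
  have "s\<^sup>2 * B \<le> A * (t (k - 1))\<^sup>2"
  proof (cases "B \<le> 0")
    case True
    then have "s\<^sup>2 * B \<le> 0" by (simp add: mult_nonneg_nonpos)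
    then show ?thesis using \<open>0 < A\<close> by (smt (verit) mult_nonneg_nonneg zero_le_power2)
  next
    case False
    then have "ereal s \<le> ereal (sqrt (A / B) * t (k - 1))"
      using assms(1) unfolding step_upper_def A_def[symmetric] B_def[symmetric]
      by (simp add: ereal_sqrt_def)
    then have "s\<^sup>2 \<le> (sqrt (A / B) * t (k - 1))\<^sup>2"
      using assms(2) by (intro power_mono) auto
    also have "\<dots> = A / B * (t (k - 1))\<^sup>2"
      using False \<open>0 < A\<close> by (simp add: power_mult_distrib)
    finally show ?thesis using False by (simp add: field_simps)
  qed
  then show ?thesis by (simp add: A_def B_def)
qed

text \<open>Below the threshold \<open>c\<close> the other term of the minimum is active, so the ratio of stepsizes is at
  least \<open>sqrt (2 / 3)\<close>. If the next stepsize is below \<open>c\<close> too, its ratio is at least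
  \<open>1\<close>, since \<open>2 / 3 + sqrt (2 / 3) \<ge> 1\<close>. So the stepsize following one of size at least \<open>c\<close> is at
  least \<open>sqrt (2 / 3) * c\<close>, and from then on the stepsizes do not decrease while they stay below
  \<open>c\<close>.\<close>

lemma stepsizes_bounded_below:
  fixes t \<theta> :: "nat \<Rightarrow> real"
  assumes pos: "\<And>k. 0 < t k" "\<And>k. 0 < \<theta> k" and "0 < c"
    and theta: "\<And>k. \<theta> (Suc k) = t (Suc k) / t k"
    and lower: "\<And>k. min (sqrt (2 / 3 + \<theta> k) * t k) c \<le> t (Suc k)"
  obtains m where "0 < m" "\<And>k. m \<le> t (Suc k)"
proof -
  define m where "m = min (sqrt (2 / 3) * c) (t 1)"
  have ratio: "sqrt (2 / 3 + \<theta> k) \<le> \<theta> (Suc k)" if "t (Suc k) < c" for k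
    using lower[of k] that pos(1)[of k] by (simp add: theta field_simps)
  have sqrt23: "1 / 3 \<le> sqrt (2 / 3 :: real)"
    by (rule real_le_rsqrt) (simp add: power2_eq_square)
  have "m \<le> t (Suc k)" for k
  proof (induction k)
    case 0
    show ?case by (simp add: m_def)
  next
    case (Suc k)
    show ?case
    proof (cases "t (Suc (Suc k)) < c")
      case False
      have "sqrt (2 / 3) * c \<le> 1 * c"
        using \<open>0 < c\<close> by (intro mult_right_mono) auto
      then show ?thesis using False by (simp add: m_def)
    next
      case True
      have step: "sqrt (2 / 3 + \<theta> (Suc k)) * t (Suc k) \<le> t (Suc (Suc k))"
        using ratio[OF True] pos(1)[of "Suc k"] theta[of "Suc k"] by (simp add: field_simps)
      show ?thesis
      proof (cases "t (Suc k) < c")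
        case False
        have "sqrt (2 / 3) * c \<le> sqrt (2 / 3 + \<theta> (Suc k)) * t (Suc k)"
          using False pos(2)[of "Suc k"] \<open>0 < c\<close> by (intro mult_mono) auto
        then show ?thesis using step by (simp add: m_def)
      next
        case True
        have "sqrt (2 / 3) \<le> sqrt (2 / 3 + \<theta> k)" using pos(2)[of k] by simp
        then have "1 / 3 \<le> \<theta> (Suc k)" using ratio[OF True] sqrt23 by linarith
        then have "1 \<le> sqrt (2 / 3 + \<theta> (Suc k))" by simp
        then have "1 * t (Suc k) \<le> sqrt (2 / 3 + \<theta> (Suc k)) * t (Suc k)"
          using pos(1)[of "Suc k"] by (intro mult_right_mono) auto
        then show ?thesis using step Suc.IH by simp
      qed
    qed
  qed
  moreover have "0 < m" using \<open>0 < c\<close> pos(1) by (simp add: m_def)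
  ultimately show ?thesis using that by blast
qed

section \<open>The energy estimate\<close>

text \<open>Twice the squared norm of \<open>g x1\<close> splits as
  \<open>(2 * norm (g x1 - g x0)^2 - norm (g x0)^2) - norm (g x0)^2 + 4 * inner (g x0) (g x1)\<close>.
  The bracket is what \<open>curvature\<close> controls. Monotonicity of the gradient gives
  \<open>inner (g x0) (g x1) \<le> norm (g x0)^2\<close>, so one of the four inner products cancels against the
  negative square; the three that are left cause the factor \<open>3\<close> in the energy and the \<open>2 / 3\<close> in the
  growth restriction.\<close>

lemma energy_decrease:
  fixes f :: "'a::real_inner \<Rightarrow> real"
  assumes convex: "convex_on UNIV f" and gradient: "\<And>z. GDERIV f z :> g z"
    and pos: "0 < a" "0 < b"
    and x1: "x1 = x0 - a *\<^sub>R g x0" and x2: "x2 = x1 - b *\<^sub>R g x1"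
    and growth: "b\<^sup>2 \<le> (2 / 3 + \<theta>) * a\<^sup>2"
    and curvature: "b\<^sup>2 * (2 * (norm (g x1 - g x0))\<^sup>2 - (norm (g x0))\<^sup>2) \<le> (norm (x1 - x0))\<^sup>2 + \<gamma>"
    and z: "f z \<le> f x0"
  shows "(norm (x2 - z))\<^sup>2 + (norm (x2 - x1))\<^sup>2 + b * (2 + 3 * (b / a)) * (f x1 - f z)
      + 2 * b * bregman f g z x1
    \<le> (norm (x1 - z))\<^sup>2 + (norm (x1 - x0))\<^sup>2 + a * (2 + 3 * \<theta>) * (f x0 - f z) + \<gamma>"
proof -
  have expand: "(norm (x2 - z))\<^sup>2 + (norm (x2 - x1))\<^sup>2 + 2 * b * (f x1 - f z) + 2 * b * bregman f g z x1
      = (norm (x1 - z))\<^sup>2 + 2 * b\<^sup>2 * (norm (g x1))\<^sup>2"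
  proof -
    have square: "(norm (v - w))\<^sup>2 = (norm v)\<^sup>2 - 2 * inner w v + (norm w)\<^sup>2" for v w :: 'a
      by (simp only: power2_norm_eq_inner inner_diff_left inner_diff_right inner_commute)
    have "x2 - z = (x1 - z) - b *\<^sub>R g x1" by (simp add: x2)
    then have "(norm (x2 - z))\<^sup>2
        = (norm (x1 - z))\<^sup>2 - 2 * b * inner (g x1) (x1 - z) + b\<^sup>2 * (norm (g x1))\<^sup>2"
      by (simp only: square) (simp add: power_mult_distrib)
    moreover have "(norm (x2 - x1))\<^sup>2 = b\<^sup>2 * (norm (g x1))\<^sup>2"
      by (simp add: x2 power_mult_distrib)
    moreover have "2 * b * (f x1 - f z) + 2 * b * bregman f g z x1 = 2 * b * inner (g x1) (x1 - z)"
      by (simp add: bregman_def inner_diff_right algebra_simps)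
    ultimately show ?thesis by simp
  qed
  have mono: "inner (g x0) (g x1) \<le> (norm (g x0))\<^sup>2"
  proof -
    have "0 \<le> a * ((norm (g x0))\<^sup>2 - inner (g x0) (g x1))"
      using convex_gradient_monotone[OF convex gradient, of x0 x1]
      by (simp add: x1 power2_norm_eq_inner inner_diff_left inner_commute algebra_simps)
    then show ?thesis using pos(1) by (simp add: zero_le_mult_iff)
  qed
  have "2 * b\<^sup>2 * (norm (g x1))\<^sup>2 = b\<^sup>2 * (2 * (norm (g x1 - g x0))\<^sup>2 - (norm (g x0))\<^sup>2)
      + b\<^sup>2 * (inner (g x0) (g x1) - (norm (g x0))\<^sup>2) + 3 * b\<^sup>2 * inner (g x0) (g x1)"
    by (simp add: power2_norm_eq_inner inner_commute algebra_simps)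
  also have "\<dots> \<le> (norm (x1 - x0))\<^sup>2 + \<gamma> + 3 * b\<^sup>2 * inner (g x0) (g x1)"
    using curvature mult_nonneg_nonpos[of "b\<^sup>2" "inner (g x0) (g x1) - (norm (g x0))\<^sup>2"] mono by simp
  also have "3 * b\<^sup>2 * inner (g x0) (g x1) = 3 * (b\<^sup>2 / a) * inner (g x1) (x0 - x1)"
    using pos(1) by (simp add: x1 inner_commute)
  also have "\<dots> \<le> 3 * (b\<^sup>2 / a) * (f x0 - f x1)"
    using convex_gradient_inequality[OF convex gradient, of x1 x0] pos
    by (intro mult_left_mono) auto
  also have "\<dots> = 3 * (b\<^sup>2 / a) * (f x0 - f z) - 3 * (b\<^sup>2 / a) * (f x1 - f z)"
    by (simp only: right_diff_distrib)
  also have "3 * (b\<^sup>2 / a) * (f x0 - f z) \<le> a * (2 + 3 * \<theta>) * (f x0 - f z)"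
    using growth pos z by (intro mult_right_mono) (auto simp: field_simps power2_eq_square)
  finally have "2 * b\<^sup>2 * (norm (g x1))\<^sup>2
      \<le> (norm (x1 - x0))\<^sup>2 + \<gamma> + a * (2 + 3 * \<theta>) * (f x0 - f z) - 3 * (b\<^sup>2 / a) * (f x1 - f z)"
    by simp
  moreover have "b * (2 + 3 * (b / a)) * (f x1 - f z)
      = 2 * b * (f x1 - f z) + 3 * (b\<^sup>2 / a) * (f x1 - f z)"
    by (simp add: algebra_simps power2_eq_square)
  ultimately show ?thesis using expand by linarith
qed

lemma quasi_decreasing_bounded_summable:
  fixes \<Phi> e \<gamma> :: "nat \<Rightarrow> real"
  assumes step: "\<And>k. \<Phi> (Suc k) + e k \<le> \<Phi> k + \<gamma> k"
    and nonneg: "\<And>k. 0 \<le> \<Phi> k" "\<And>k. 0 \<le> e k" "\<And>k. 0 \<le> \<gamma> k" and "summable \<gamma>"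
  shows "\<Phi> k \<le> \<Phi> 0 + suminf \<gamma>" and "summable e"
proof -
  have partial: "\<Phi> n + (\<Sum>k<n. e k) \<le> \<Phi> 0 + suminf \<gamma>" for n
  proof -
    have "\<Phi> n + (\<Sum>k<n. e k) \<le> \<Phi> 0 + (\<Sum>k<n. \<gamma> k)"
    proof (induction n)
      case (Suc n)
      then show ?case using step[of n] by simp
    qed simp
    also have "(\<Sum>k<n. \<gamma> k) \<le> suminf \<gamma>"
      using \<open>summable \<gamma>\<close> nonneg(3) by (intro sum_le_suminf) auto
    finally show ?thesis by simp
  qed
  show "\<Phi> k \<le> \<Phi> 0 + suminf \<gamma>"
    using partial[of k] sum_nonneg[of "{..<k}" e] nonneg(2) by auto
  show "summable e"
  proof (rule summableI_nonneg_bounded)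
    show "(\<Sum>k<n. e k) \<le> \<Phi> 0 + suminf \<gamma>" for n
      using partial[of n] nonneg(1)[of n] by simp
  qed (rule nonneg(2))
qed

section \<open>Boundedness and accumulation points\<close>

theorem theorem4:
  fixes f :: "real ^ 'n \<Rightarrow> real"
    and g :: "real ^ 'n \<Rightarrow> real ^ 'n"
    and x :: "nat \<Rightarrow> real ^ 'n"
    and t \<theta> \<gamma> :: "nat \<Rightarrow> real"
    and \<delta> :: real
  assumes convex: "convex_on UNIV f"
    and gradient: "\<And>z. GDERIV f z :> g z"
    and loc_lipschitz: "locally_lipschitz g"
    and solvable: "\<exists>z. is_arg_min f (\<lambda>_. True) z"
    and t0: "t 0 > 0"
    and theta0: "\<theta> 0 > 0"
    and theta: "\<And>k. k \<ge> 1 \<Longrightarrow> \<theta> k = t k / t (k - 1)"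
    and delta: "0 < \<delta>" "\<delta> < 1"
    and gamma_nonneg: "\<And>k. k \<ge> 1 \<Longrightarrow> \<gamma> k \<ge> 0"
    and gamma_summable: "summable (\<lambda>k. \<gamma> (Suc k))"
    and iteration: "\<And>k. x (Suc k) = x k - t k *\<^sub>R g (x k)"
    and no_termination: "\<And>k. g (x k) \<noteq> 0"
    and stepsize: "\<And>k. k \<ge> 1 \<Longrightarrow>
      ereal (t k) \<in> {step_lower g \<delta> x t \<theta> k .. step_upper g \<gamma> x t \<theta> k}"
  shows "bounded (range x) \<and>
    (\<forall>p. accumulation_point x p \<longrightarrow> is_arg_min f (\<lambda>_. True) p)"
proof -
  obtain z where z: "\<And>y. f z \<le> f y"
    using solvable by (auto simp: is_arg_min_linorder)
  have theta_Suc: "\<theta> (Suc k) = t (Suc k) / t k" for k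
    using theta[of "Suc k"] by simp
  have lower: "min (sqrt (2 / 3 + \<theta> k) * t k) (\<delta> / (sqrt 2 * C)) \<le> t (Suc k)"
    if "0 < C" "local_lip g x (Suc k) \<le> C" for C k
    using step_lower_real[of g \<delta> x t \<theta> "Suc k" "t (Suc k)" C] stepsize[of "Suc k"] delta that by simp
  have pos: "0 < t k \<and> 0 < \<theta> k" for k
  proof (induction k)
    case 0
    show ?case using t0 theta0 by simp
  next
    case (Suc k)
    \<comment> \<open>At a single index any positive bound of \<open>local_lip\<close> will do; adding \<open>1\<close> makes it positive.\<close>
    define C where "C = local_lip g x (Suc k) + 1"
    have "0 < C" by (simp add: C_def local_lip_def add_nonneg_pos)
    then have "0 < min (sqrt (2 / 3 + \<theta> k) * t k) (\<delta> / (sqrt 2 * C))"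
      using Suc.IH delta by simp
    also have "\<dots> \<le> t (Suc k)" using lower[OF \<open>0 < C\<close>] by (simp add: C_def)
    finally show ?case using Suc.IH by (simp add: theta_Suc)
  qed

  define \<Phi> where "\<Phi> k = (norm (x (Suc k) - z))\<^sup>2 + (norm (x (Suc k) - x k))\<^sup>2
    + t k * (2 + 3 * \<theta> k) * (f (x k) - f z)" for k
  define e where "e k = 2 * t (Suc k) * bregman f g z (x (Suc k))" for k
  have Phi_step: "\<Phi> (Suc k) + e k \<le> \<Phi> k + \<gamma> (Suc k)" for k
  proof -
    define N where "N = norm (x (Suc k) - x k)"
    define L where "L = local_lip g x (Suc k)"
    have upper: "ereal (t (Suc k)) \<le> step_upper g \<gamma> x t \<theta> (Suc k)"
      using stepsize[of "Suc k"] by simp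
    have growth: "(t (Suc k))\<^sup>2 \<le> (2 / 3 + \<theta> k) * (t k)\<^sup>2"
      using step_upper_growth[OF upper] pos[of k] pos[of "Suc k"] by simp
    have N: "N = t k * norm (g (x k))" using pos[of k] by (simp add: N_def iteration)
    then have "0 < N" using pos[of k] no_termination[of k] by simp
    have L: "norm (g (x (Suc k)) - g (x k)) = L * N"
      using \<open>0 < N\<close> by (simp add: L_def local_lip_def N_def)
    \<comment> \<open>Multiplied by the squared norm of \<open>g (x k)\<close>, the curvature bound loses its quotients.\<close>
    have "(t (Suc k))\<^sup>2 * (2 * (norm (g (x (Suc k)) - g (x k)))\<^sup>2 - (norm (g (x k)))\<^sup>2)
        = (t (Suc k))\<^sup>2 * (2 * (t k)\<^sup>2 * L\<^sup>2 - 1) * (norm (g (x k)))\<^sup>2"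
      unfolding L by (simp add: N power_mult_distrib algebra_simps)
    also have "\<dots> \<le> (1 + \<gamma> (Suc k) / N\<^sup>2) * (t k)\<^sup>2 * (norm (g (x k)))\<^sup>2"
      using step_upper_curvature[OF upper] pos[of k] pos[of "Suc k"] gamma_nonneg[of "Suc k"]
      by (intro mult_right_mono) (auto simp: L_def N_def)
    also have "\<dots> = (1 + \<gamma> (Suc k) / N\<^sup>2) * N\<^sup>2"
      by (simp add: N power_mult_distrib)
    also have "\<dots> = N\<^sup>2 + \<gamma> (Suc k)"
      using \<open>0 < N\<close> by (simp add: field_simps)
    finally have curvature: "(t (Suc k))\<^sup>2 * (2 * (norm (g (x (Suc k)) - g (x k)))\<^sup>2
        - (norm (g (x k)))\<^sup>2) \<le> (norm (x (Suc k) - x k))\<^sup>2 + \<gamma> (Suc k)"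
      by (simp add: N_def)
    show ?thesis
      using energy_decrease[OF convex gradient _ _ iteration[of k] iteration[of "Suc k"] growth
          curvature z] pos[of k] pos[of "Suc k"]
      by (simp add: \<Phi>_def e_def theta_Suc)
  qed
  have excess: "0 \<le> t k * (2 + 3 * \<theta> k) * (f (x k) - f z)" for k
    using pos[of k] z[of "x k"] by simp
  have "0 \<le> \<Phi> k" and "0 \<le> e k" and "0 \<le> \<gamma> (Suc k)" for k
    using excess[of k] bregman_nonneg[OF convex gradient] pos[of "Suc k"] gamma_nonneg[of "Suc k"]
    by (auto simp: \<Phi>_def e_def)
  then have bound: "\<Phi> k \<le> \<Phi> 0 + (\<Sum>n. \<gamma> (Suc n))" and "summable e" for k
    using quasi_decreasing_bounded_summable[of \<Phi> e "\<lambda>n. \<gamma> (Suc n)", OF Phi_step] gamma_summable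
    by blast+

  have "bounded (range x)"
  proof -
    define R where "R = sqrt (\<Phi> 0 + (\<Sum>n. \<gamma> (Suc n)))"
    have "(norm (x (Suc k) - z))\<^sup>2 \<le> \<Phi> k" for k
      using excess[of k] by (simp add: \<Phi>_def)
    then have "norm (x (Suc k) - z) \<le> R" for k
      unfolding R_def using bound[of k] by (intro real_le_rsqrt) (rule order_trans)
    then have "range (\<lambda>k. x (Suc k)) \<subseteq> cball z R"
      by (auto simp: dist_norm norm_minus_commute)
    then have "bounded (insert (x 0) (range (\<lambda>k. x (Suc k))))"
      by (simp add: bounded_subset[OF bounded_cball])
    moreover have "range x \<subseteq> insert (x 0) (range (\<lambda>k. x (Suc k)))"
      by (auto simp: image_iff) (metis not0_implies_Suc)
    ultimately show ?thesis by (rule bounded_subset)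
  qed

  obtain C where C: "0 < C" "\<And>k. local_lip g x k \<le> C"
    using local_lip_bounded[OF loc_lipschitz \<open>bounded (range x)\<close>] by blast
  obtain m where m: "0 < m" "\<And>k. m \<le> t (Suc k)"
    using stepsizes_bounded_below[of t \<theta> "\<delta> / (sqrt 2 * C)"] pos theta_Suc lower[OF C(1) C(2)]
      delta C(1) by auto
  have "(\<lambda>k. bregman f g z (x (Suc k))) \<longlonglongrightarrow> 0"
  proof (rule tendsto_sandwich[OF always_eventually always_eventually])
    show "\<forall>k. 0 \<le> bregman f g z (x (Suc k))"
      using bregman_nonneg[OF convex gradient] by blast
    show "\<forall>k. bregman f g z (x (Suc k)) \<le> e k / (2 * m)"
      using mult_right_mono[OF m(2) bregman_nonneg[OF convex gradient]] m(1)
      by (auto simp: e_def field_simps)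
    show "(\<lambda>k. e k / (2 * m)) \<longlonglongrightarrow> 0"
      using tendsto_divide[OF summable_LIMSEQ_zero[OF \<open>summable e\<close>] tendsto_const, of "2 * m"] m(1)
      by simp
  qed simp
  then have bregman_limit: "(\<lambda>k. bregman f g z (x k)) \<longlonglongrightarrow> 0"
    by (rule LIMSEQ_imp_Suc)

  have "is_arg_min f (\<lambda>_. True) p" if accumulation: "accumulation_point x p" for p
  proof -
    obtain r where r: "strict_mono r" "(x \<circ> r) \<longlonglongrightarrow> p"
      using accumulation by (auto simp: accumulation_point_def)
    have "isCont f p"
      using gradient[of p] by (auto simp: gderiv_def intro: has_derivative_continuous)
    moreover have "isCont g p"
      using locally_lipschitz_imp_continuous[OF loc_lipschitz] by (simp add: continuous_on_eq_continuous_at)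
    ultimately have "isCont (\<lambda>w. bregman f g z w) p"
      unfolding bregman_def by (intro continuous_intros)
    then have "(\<lambda>n. bregman f g z ((x \<circ> r) n)) \<longlonglongrightarrow> bregman f g z p"
      using r(2) by (rule isCont_tendsto_compose)
    moreover have "(\<lambda>n. bregman f g z ((x \<circ> r) n)) \<longlonglongrightarrow> 0"
      using LIMSEQ_subseq_LIMSEQ[OF bregman_limit r(1)] by (simp add: o_def)
    ultimately have "bregman f g z p = 0" by (rule LIMSEQ_unique)
    then have "g z = g p" by (rule bregman_eq_0_imp_gradient_eq[OF convex gradient])
    moreover have "g z = 0" using gradient z by (rule gradient_at_minimum)
    ultimately have "f p \<le> f y" for y
      using convex_gradient_inequality[OF convex gradient, of p y] by simp
    then show ?thesis by (simp add: is_arg_min_linorder)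
  qed
  with \<open>bounded (range x)\<close> show ?thesis by blast
qed

end
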